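(* Let $\chi_1$, $\chi_2$ and $\chi_3$ be three independent and identically distributed functional random variables in $L^{2}(T)$ with mean function $\mu_{\chi}$ and compact covariance operator $\Gamma_{\chi}$. For any positive integer $K$ with $\lambda_K>0$, $d_{FM}^{K}$ verifies the following three properties: 1. $d_{FM}^{K}(\chi_1,\chi_2)\geq 0$. 2. $d_{FM}^{K}(\chi_1,\chi_2)=d_{FM}^{K}(\chi_2,\chi_1)$. 3. $d_{FM}^{K}(\chi_1,\chi_2)\leq d_{FM}^{K}(\chi_1,\chi_3)+d_{FM}^{K}(\chi_3,\chi_2)$. Consequently, $d_{FM}^{K}$ is a functional semi-distance.
   Context: $T=[a,b]$ is a closed interval of the real line and $L^{2}(T)$ is the real Hilbert space of square integrable functions on $T$, with inner product $\langle f,g\rangle=\int_T f(t)g(t)\,dt$ and norm $\|\cdot\|_2$. A functional random variable $\chi$ is a random element of $L^2(T)$; it is assumed throughout that $E[\|\chi\|_2^4]<\infty$. Its mean function is $\mu_\chi(t)=E[\chi(t)]$ and its covariance operator is $\Gamma_\chi(\eta)=E[\langle \chi-\mu_\chi,\eta\rangle(\chi-\mu_\chi)]$ for $\eta\in L^2(T)$, which is compact. Here $\mu_\chi$ and $\Gamma_\chi$ are the common mean function and covariance operator of $\chi_1,\chi_2,\chi_3$. Let $\lambda_1\ge\lambda_2\ge\cdots\ge 0$ be the eigenvalues of $\Gamma_\chi$ ($\sum_k\lambda_k<\infty$), and let $\psi_1,\psi_2,\ldots$ be a fixed associated sequence of orthonormal eigenfunctions, $\Gamma_\chi(\psi_k)=\lambda_k\psi_k$,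 forming an orthonormal basis of $L^2(T)$. For functions $f,g$, $(f\otimes f)(g)=\langle f,g\rangle f$. For a positive integer $K$ with $\lambda_K>0$, the regularized square root inverse operator is $$\Gamma_K^{-1/2}(\zeta)=\sum_{k=1}^K\frac{1}{\lambda_k^{1/2}}(\psi_k\otimes\psi_k)(\zeta)=\sum_{k=1}^K\frac{\langle\psi_k,\zeta\rangle}{\lambda_k^{1/2}}\psi_k .$$ The functional Mahalanobis semi-distance between $\chi_i$ and $\chi_j$ is $$d_{FM}^K(\chi_i,\chi_j)=\left\langle\Gamma_K^{-1/2}(\chi_i-\chi_j),\Gamma_K^{-1/2}(\chi_i-\chi_j)\right\rangle^{1/2}.$$ "Functional semi-distance" refers to a map satisfying the three listed properties (non-negativity, symmetry, triangle inequality); it is not required that distance zero imply equality of the functions. *)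

theory Defs
  imports "HOL-Probability.Probability"
begin

section \<open>The Hilbert space of square integrable functions on the real line\<close>

text \<open>
  The type \<open>l2\<close> is the space of square integrable functions on the whole line, modulo equality
  almost everywhere, with the inner product given by the integral of the product. It is made an
  instance of \<^class>\<open>real_inner\<close>, \<^class>\<open>banach\<close> and \<^class>\<open>second_countable_topology\<close>, so that
  the library's Borel sets, Bochner integrals and independence apply to it. The space for a
  closed interval is the closed subspace \<open>L2_on\<close> below.
\<close>

definition square_integrable :: "(real \<Rightarrow> real) \<Rightarrow> bool" where
  "square_integrable f \<longleftrightarrow>
     f \<in> borel_measurable lborel \<and> integrable lborel (\<lambda>t. (f t)\<^sup>2)"

lemma square_integrable_measurable:
  "square_integrable f \<Longrightarrow> f \<in> borel_measurable lborel"
  by (simp add: square_integrable_def)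

lemma square_integrable_zero: "square_integrable (\<lambda>t. 0)"
  by (simp add: square_integrable_def)

lemma square_integrable_bound:
  assumes "square_integrable g" "f \<in> borel_measurable lborel"
    and "AE t in lborel. \<bar>f t\<bar> \<le> \<bar>g t\<bar>"
  shows "square_integrable f"
  unfolding square_integrable_def
proof
  have [measurable]: "f \<in> borel_measurable lborel" by fact
  show "integrable lborel (\<lambda>t. (f t)\<^sup>2)"
  proof (rule Bochner_Integration.integrable_bound)
    show "integrable lborel (\<lambda>t. (g t)\<^sup>2)"
      using assms(1) by (simp add: square_integrable_def)
    show "AE t in lborel. norm ((f t)\<^sup>2) \<le> norm ((g t)\<^sup>2)"
      using assms(3) by eventually_elim (simp add: abs_le_square_iff)
  qed measurable
qed fact

lemma square_integrable_cmult:
  "square_integrable f \<Longrightarrow> square_integrable (\<lambda>t. c * f t)"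
  by (auto simp: square_integrable_def power_mult_distrib)

lemma square_integrable_add:
  assumes "square_integrable f" "square_integrable g"
  shows "square_integrable (\<lambda>t. f t + g t)"
  unfolding square_integrable_def
proof
  have [measurable]: "f \<in> borel_measurable lborel" "g \<in> borel_measurable lborel"
    using assms by (auto simp: square_integrable_def)
  show "(\<lambda>t. f t + g t) \<in> borel_measurable lborel" by measurable
  have "(x + y)\<^sup>2 \<le> 2 * x\<^sup>2 + 2 * y\<^sup>2" for x y :: real
    using zero_le_power2[of "x - y"] by (simp add: power2_eq_square algebra_simps)
  moreover have "integrable lborel (\<lambda>t. 2 * (f t)\<^sup>2 + 2 * (g t)\<^sup>2)"
    using assms by (auto simp: square_integrable_def)
  ultimately show "integrable lborel (\<lambda>t. (f t + g t)\<^sup>2)"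
    by (elim Bochner_Integration.integrable_bound) simp_all
qed

lemma square_integrable_uminus: "square_integrable f \<Longrightarrow> square_integrable (\<lambda>t. - f t)"
  by (auto simp: square_integrable_def)

lemma square_integrable_diff:
  "square_integrable f \<Longrightarrow> square_integrable g \<Longrightarrow> square_integrable (\<lambda>t. f t - g t)"
  using square_integrable_add[of f "\<lambda>t. - g t"] square_integrable_uminus[of g] by simp

lemma square_integrable_mult_integrable:
  assumes "square_integrable f" "square_integrable g"
  shows "integrable lborel (\<lambda>t. f t * g t)"
proof -
  have [measurable]: "f \<in> borel_measurable lborel" "g \<in> borel_measurable lborel"
    using assms by (auto simp: square_integrable_def)
  have "\<bar>x * y\<bar> \<le> x\<^sup>2 + y\<^sup>2" for x y :: real
  proof -
    have "2 * (\<bar>x\<bar> * \<bar>y\<bar>) \<le> x\<^sup>2 + y\<^sup>2"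
      using zero_le_power2[of "\<bar>x\<bar> - \<bar>y\<bar>"] by (simp add: power2_diff algebra_simps)
    moreover have "\<bar>x\<bar> * \<bar>y\<bar> \<ge> 0" by simp
    ultimately show ?thesis unfolding abs_mult by linarith
  qed
  moreover have "integrable lborel (\<lambda>t. (f t)\<^sup>2 + (g t)\<^sup>2)"
    using assms by (auto simp: square_integrable_def)
  ultimately show ?thesis
    by (elim Bochner_Integration.integrable_bound) simp_all
qed

definition ae_eq :: "(real \<Rightarrow> real) \<Rightarrow> (real \<Rightarrow> real) \<Rightarrow> bool" where
  "ae_eq f g \<longleftrightarrow> square_integrable f \<and> square_integrable g \<and> (AE t in lborel. f t = g t)"

quotient_type l2 = "real \<Rightarrow> real" / partial: ae_eq
proof (rule part_equivpI)
  show "\<exists>f. ae_eq f f"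
    by (intro exI[of _ "\<lambda>t. 0"]) (simp add: ae_eq_def square_integrable_zero)
  show "symp ae_eq"
    by (auto simp: symp_def ae_eq_def eq_commute)
  show "transp ae_eq"
    unfolding transp_def ae_eq_def
  proof (intro allI impI conjI; (elim conjE)?)
    fix f g h :: "real \<Rightarrow> real"
    assume "AE t in lborel. f t = g t" "AE t in lborel. g t = h t"
    then show "AE t in lborel. f t = h t" by eventually_elim simp
  qed auto
qed

instantiation l2 :: real_vector
begin

lift_definition zero_l2 :: l2 is "\<lambda>t. 0"
  by (simp add: ae_eq_def square_integrable_zero)

lift_definition plus_l2 :: "l2 \<Rightarrow> l2 \<Rightarrow> l2" is "\<lambda>f g t. f t + g t"
proof -
  fix f f' g g' assume *: "ae_eq f f'" "ae_eq g g'"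
  then have "AE t in lborel. f t = f' t" "AE t in lborel. g t = g' t"
    by (auto simp: ae_eq_def)
  then have "AE t in lborel. f t + g t = f' t + g' t" by eventually_elim simp
  with * show "ae_eq (\<lambda>t. f t + g t) (\<lambda>t. f' t + g' t)"
    by (auto simp: ae_eq_def intro: square_integrable_add)
qed

lift_definition uminus_l2 :: "l2 \<Rightarrow> l2" is "\<lambda>f t. - f t"
  by (auto simp: ae_eq_def square_integrable_uminus)

lift_definition minus_l2 :: "l2 \<Rightarrow> l2 \<Rightarrow> l2" is "\<lambda>f g t. f t - g t"
proof -
  fix f f' g g' assume *: "ae_eq f f'" "ae_eq g g'"
  then have "AE t in lborel. f t = f' t" "AE t in lborel. g t = g' t"
    by (auto simp: ae_eq_def)
  then have "AE t in lborel. f t - g t = f' t - g' t" by eventually_elim simp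
  with * show "ae_eq (\<lambda>t. f t - g t) (\<lambda>t. f' t - g' t)"
    by (auto simp: ae_eq_def intro: square_integrable_diff)
qed

lift_definition scaleR_l2 :: "real \<Rightarrow> l2 \<Rightarrow> l2" is "\<lambda>c f t. c * f t"
  by (auto simp: ae_eq_def square_integrable_cmult)

instance
proof
  fix x y z :: l2 and a b :: real
  show "x + y + z = x + (y + z)"
    by transfer (simp add: ae_eq_def add.assoc square_integrable_add)
  show "x + y = y + x"
    by transfer (simp add: ae_eq_def add.commute square_integrable_add)
  show "0 + x = x"
    by transfer (simp add: ae_eq_def)
  show "- x + x = 0"
    by transfer (simp add: ae_eq_def square_integrable_zero)
  show "x - y = x + - y"
    by transfer (simp add: ae_eq_def square_integrable_diff)
  show "a *\<^sub>R (x + y) = a *\<^sub>R x + a *\<^sub>R y"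
    by transfer (simp add: ae_eq_def distrib_left square_integrable_add square_integrable_cmult)
  show "(a + b) *\<^sub>R x = a *\<^sub>R x + b *\<^sub>R x"
    by transfer (simp add: ae_eq_def distrib_right square_integrable_add square_integrable_cmult)
  show "a *\<^sub>R b *\<^sub>R x = (a * b) *\<^sub>R x"
    by transfer (simp add: ae_eq_def mult.assoc square_integrable_cmult)
  show "1 *\<^sub>R x = x"
    by transfer (simp add: ae_eq_def)
qed

end

instantiation l2 :: real_inner
begin

lift_definition inner_l2 :: "l2 \<Rightarrow> l2 \<Rightarrow> real" is "\<lambda>f g. LINT t|lborel. f t * g t"
proof -
  fix f f' g g' assume *: "ae_eq f f'" "ae_eq g g'"
  then have "AE t in lborel. f t = f' t" "AE t in lborel. g t = g' t"
    by (auto simp: ae_eq_def)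
  then have "AE t in lborel. f t * g t = f' t * g' t" by eventually_elim simp
  then show "(LINT t|lborel. f t * g t) = (LINT t|lborel. f' t * g' t)"
    using * by (intro integral_cong_AE) (auto simp: ae_eq_def square_integrable_def)
qed

definition norm_l2 :: "l2 \<Rightarrow> real" where "norm_l2 x = sqrt (inner x x)"

definition sgn_l2 :: "l2 \<Rightarrow> l2" where "sgn_l2 x = x /\<^sub>R norm x"

definition dist_l2 :: "l2 \<Rightarrow> l2 \<Rightarrow> real" where "dist_l2 x y = norm (x - y)"

definition uniformity_l2 :: "(l2 \<times> l2) filter" where
  "uniformity_l2 = (INF e\<in>{0<..}. principal {(x, y). dist x y < e})"

definition open_l2 :: "l2 set \<Rightarrow> bool" where
  "open_l2 U \<longleftrightarrow> (\<forall>x\<in>U. eventually (\<lambda>(x', y). x' = x \<longrightarrow> y \<in> U) uniformity)"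

instance
proof
  fix x y z :: l2 and a :: real
  show "sgn x = x /\<^sub>R norm x" by (rule sgn_l2_def)
  show "dist x y = norm (x - y)" by (rule dist_l2_def)
  show "(uniformity :: (l2 \<times> l2) filter) = (INF e\<in>{0<..}. principal {(x, y). dist x y < e})"
    by (rule uniformity_l2_def)
  show "open U \<longleftrightarrow> (\<forall>x\<in>U. eventually (\<lambda>(x', y). x' = x \<longrightarrow> y \<in> U) uniformity)" for U :: "l2 set"
    by (rule open_l2_def)
  show "inner x y = inner y x" by transfer (simp add: mult.commute)
  show "inner (x + y) z = inner x z + inner y z"
    by transfer (simp add: ae_eq_def algebra_simps square_integrable_mult_integrable)
  show "inner (a *\<^sub>R x) y = a * inner x y"
    by transfer (simp add: mult.assoc)
  show "0 \<le> inner x x" by transfer simp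
  show "inner x x = 0 \<longleftrightarrow> x = 0"
  proof transfer
    fix f assume "ae_eq f f"
    then have f: "square_integrable f" by (simp add: ae_eq_def)
    have "(LINT t|lborel. f t * f t) = 0 \<longleftrightarrow> (AE t in lborel. f t * f t = 0)"
      by (rule integral_nonneg_eq_0_iff_AE) (use f in \<open>auto intro: square_integrable_mult_integrable\<close>)
    then show "(LINT t|lborel. f t * f t) = 0 \<longleftrightarrow> ae_eq f (\<lambda>t. 0)"
      using f by (simp add: ae_eq_def square_integrable_zero)
  qed
  show "norm x = sqrt (inner x x)" by (rule norm_l2_def)
qed

end

lemma square_integrable_rep: "square_integrable (rep_l2 x)"
  using Quotient_rep_reflp[OF Quotient_l2, of x] by (simp add: ae_eq_def)


lemma ae_eq_refl: "square_integrable f \<Longrightarrow> ae_eq f f"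
  by (simp add: ae_eq_def)

lemma abs_rep_l2: "abs_l2 (rep_l2 x) = x"
  by (rule Quotient_abs_rep[OF Quotient_l2])

lemma abs_l2_cong_AE:
  "square_integrable f \<Longrightarrow> square_integrable g \<Longrightarrow> AE t in lborel. f t = g t \<Longrightarrow>
    abs_l2 f = abs_l2 g"
  by (rule Quotient_rel_abs[OF Quotient_l2]) (simp add: ae_eq_def)

lemma abs_l2_add:
  "square_integrable f \<Longrightarrow> square_integrable g \<Longrightarrow>
    abs_l2 (\<lambda>t. f t + g t) = abs_l2 f + abs_l2 g"
  by (simp add: plus_l2.abs_eq ae_eq_refl)

lemma abs_l2_diff:
  "square_integrable f \<Longrightarrow> square_integrable g \<Longrightarrow>
    abs_l2 (\<lambda>t. f t - g t) = abs_l2 f - abs_l2 g"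
  by (simp add: minus_l2.abs_eq ae_eq_refl)

lemma abs_l2_cmult:
  "square_integrable f \<Longrightarrow> abs_l2 (\<lambda>t. c * f t) = c *\<^sub>R abs_l2 f"
  by (simp add: scaleR_l2.abs_eq ae_eq_refl)

lemma abs_l2_zero: "abs_l2 (\<lambda>t. 0) = 0"
  by (simp add: zero_l2_def)

lemma norm_abs_l2:
  "square_integrable f \<Longrightarrow> norm (abs_l2 f) = sqrt (LINT t|lborel. (f t)\<^sup>2)"
  by (simp add: norm_eq_sqrt_inner inner_l2.abs_eq ae_eq_refl power2_eq_square)

lemma nn_integral_square_l2:
  assumes "square_integrable f"
  shows "(\<integral>\<^sup>+t. ennreal ((f t)\<^sup>2) \<partial>lborel) = ennreal ((norm (abs_l2 f))\<^sup>2)"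
  using assms by (subst nn_integral_eq_integral) (auto simp: norm_abs_l2 square_integrable_def)

lemma abs_l2_tendsto_dominated:
  assumes F: "\<And>n. square_integrable (F n)" and g: "square_integrable g"
    and f [measurable]: "f \<in> borel_measurable lborel"
    and bound: "\<And>n t. \<bar>F n t\<bar> \<le> g t" and lim: "\<And>t. (\<lambda>n. F n t) \<longlonglongrightarrow> f t"
  shows "square_integrable f" and "(\<lambda>n. abs_l2 (F n)) \<longlonglongrightarrow> abs_l2 f"
proof -
  have [measurable]: "F n \<in> borel_measurable lborel" for n
    by (rule square_integrable_measurable[OF F])
  have fg: "\<bar>f t\<bar> \<le> g t" for t
    by (rule LIMSEQ_le_const2[OF tendsto_rabs[OF lim]]) (use bound in auto)
  then show sf: "square_integrable f"
    using square_integrable_bound[OF g f] by (smt (verit) AE_I2)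
  have dom: "(F n t - f t)\<^sup>2 \<le> 4 * (g t)\<^sup>2" for n t
  proof -
    have "\<bar>F n t - f t\<bar> \<le> \<bar>2 * g t\<bar>" using bound[of n t] fg[of t] by linarith
    then have "(F n t - f t)\<^sup>2 \<le> (2 * g t)\<^sup>2" by (simp only: abs_le_square_iff)
    then show ?thesis by (simp add: power_mult_distrib)
  qed
  have "(\<lambda>n. LINT t|lborel. (F n t - f t)\<^sup>2) \<longlonglongrightarrow> (LINT (t::real)|lborel. (0::real))"
  proof (rule integral_dominated_convergence[where w = "\<lambda>t. 4 * (g t)\<^sup>2"])
    show "integrable lborel (\<lambda>t. 4 * (g t)\<^sup>2)"
      using g by (simp add: square_integrable_def)
    have "(\<lambda>n. (F n t - f t)\<^sup>2) \<longlonglongrightarrow> (f t - f t)\<^sup>2" for t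
      by (intro tendsto_intros lim)
    then show "AE t in lborel. (\<lambda>n. (F n t - f t)\<^sup>2) \<longlonglongrightarrow> 0" by simp
    show "AE t in lborel. norm ((F n t - f t)\<^sup>2) \<le> 4 * (g t)\<^sup>2" for n
      using dom by simp
  qed measurable
  then have "(\<lambda>n. sqrt (LINT t|lborel. (F n t - f t)\<^sup>2)) \<longlonglongrightarrow> sqrt 0"
    by (intro tendsto_real_sqrt) simp
  then have "(\<lambda>n. norm (abs_l2 (F n) - abs_l2 f)) \<longlonglongrightarrow> 0"
    by (simp add: abs_l2_diff[symmetric] norm_abs_l2 F sf square_integrable_diff)
  then show "(\<lambda>n. abs_l2 (F n)) \<longlonglongrightarrow> abs_l2 f"
    using LIM_zero_cancel tendsto_norm_zero_iff by blast
qed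

instance l2 :: complete_space
proof
  fix X :: "nat \<Rightarrow> l2" assume X: "Cauchy X"
  define f where "f n = rep_l2 (X n)" for n
  have sf: "square_integrable (f n)" for n
    by (simp add: f_def square_integrable_rep)
  have abs_f: "abs_l2 (f n) = X n" for n
    by (simp add: f_def abs_rep_l2)
  have [measurable]: "f n \<in> borel_measurable lborel" for n
    by (rule square_integrable_measurable[OF sf])
  have diff: "(\<integral>\<^sup>+t. ennreal ((f m t - f n t)\<^sup>2) \<partial>lborel) = ennreal ((dist (X m) (X n))\<^sup>2)" for m n
    by (subst nn_integral_square_l2)
      (simp_all add: sf square_integrable_diff abs_l2_diff abs_f dist_norm)
  have "\<exists>N. \<forall>m\<ge>N. \<forall>n\<ge>N. dist (X m) (X n) < (1/4)^k" for k :: nat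
    using X unfolding Cauchy_def by simp
  then obtain N where N: "\<And>k m n. m \<ge> N k \<Longrightarrow> n \<ge> N k \<Longrightarrow> dist (X m) (X n) < (1/4)^k"
    by metis
  define r where "r = rec_nat (N 0) (\<lambda>k p. max (Suc p) (N (Suc k)))"
  have r_mono: "strict_mono r"
    unfolding strict_mono_Suc_iff by (simp add: r_def less_max_iff_disj)
  have rN: "r k \<ge> N k" for k
    by (cases k) (auto simp: r_def)
  have small: "dist (X (r (Suc k))) (X (r k)) < (1/4)^k" for k
    using rN[of k] rN[of "Suc k"] strict_monoD[OF r_mono, of k "Suc k"] by (intro N) auto
  define h where "h k t = 4^k * (f (r (Suc k)) t - f (r k) t)\<^sup>2" for k t
  have [measurable]: "h k \<in> borel_measurable lborel" for k
    unfolding h_def by measurable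
  have h_le: "(\<integral>\<^sup>+t. ennreal (h k t) \<partial>lborel) \<le> ennreal ((1/4)^k)" for k
  proof -
    have "(\<integral>\<^sup>+t. ennreal (h k t) \<partial>lborel) =
        ennreal (4^k) * (\<integral>\<^sup>+t. ennreal ((f (r (Suc k)) t - f (r k) t)\<^sup>2) \<partial>lborel)"
      unfolding h_def by (subst nn_integral_cmult[symmetric]) (auto simp: ennreal_mult)
    also have "\<dots> = ennreal (4^k * (dist (X (r (Suc k))) (X (r k)))\<^sup>2)"
      by (simp add: diff ennreal_mult)
    also have "\<dots> \<le> ennreal (4^k * ((1/4)^k)\<^sup>2)"
      using small[of k] by (intro ennreal_leI mult_left_mono power_mono) auto
    also have "(4::real)^k * ((1/4)^k)\<^sup>2 = (1/4)^k"
      by (simp add: power2_eq_square power_one_over field_simps)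
    finally show ?thesis .
  qed
  have "(\<integral>\<^sup>+t. (\<Sum>k. ennreal (h k t)) \<partial>lborel) = (\<Sum>k. \<integral>\<^sup>+t. ennreal (h k t) \<partial>lborel)"
    by (rule nn_integral_suminf) measurable
  also have "\<dots> \<le> (\<Sum>k. ennreal ((1/4)^k))"
    by (intro suminf_le h_le) auto
  also have "\<dots> = ennreal (\<Sum>k. (1/4)^k)"
    by (rule suminf_ennreal2) (auto intro: summable_geometric)
  finally have "(\<integral>\<^sup>+t. (\<Sum>k. ennreal (h k t)) \<partial>lborel) \<noteq> \<infinity>"
    by (auto simp: top_unique)
  then have "AE t in lborel. (\<Sum>k. ennreal (h k t)) \<noteq> \<infinity>"
    by (intro nn_integral_PInf_AE) auto
  then have conv: "AE t in lborel. convergent (\<lambda>k. f (r k) t)"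
  proof eventually_elim
    case (elim t)
    have h_nonneg: "0 \<le> h k t" for k by (simp add: h_def)
    have "summable (\<lambda>k. h k t)"
      by (rule summable_suminf_not_top) (use elim h_nonneg in auto)
    then have "Bseq (\<lambda>k. h k t)"
      by (intro convergent_imp_Bseq) (auto simp: convergent_def dest: summable_LIMSEQ_zero)
    then obtain C where C: "C > 0" "\<And>k. \<bar>h k t\<bar> \<le> C"
      by (auto simp: Bseq_def)
    have "\<bar>f (r (Suc k)) t - f (r k) t\<bar> \<le> sqrt C * (1/2)^k" for k
    proof -
      have "(f (r (Suc k)) t - f (r k) t)\<^sup>2 \<le> C * (1/4)^k"
        using C(2)[of k] by (simp add: h_def power_one_over field_simps)
      then have "\<bar>f (r (Suc k)) t - f (r k) t\<bar> \<le> sqrt (C * (1/4)^k)"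
        using real_le_rsqrt by force
      also have "\<dots> = sqrt C * (1/2)^k"
        by (simp add: real_sqrt_mult real_sqrt_power real_sqrt_divide)
      finally show ?thesis .
    qed
    then have le: "norm (f (r (Suc k)) t - f (r k) t) \<le> sqrt C * (1/2)^k" for k
      by simp
    have geo: "summable (\<lambda>k. sqrt C * (1/2::real)^k)"
      by (rule summable_mult) (simp add: summable_geometric)
    have "summable (\<lambda>k. f (r (Suc k)) t - f (r k) t)"
      by (rule summable_comparison_test'[OF geo le])
    then have "convergent (\<lambda>n. (\<Sum>k<n. f (r (Suc k)) t - f (r k) t) + f (r 0) t)"
      by (intro convergent_add convergent_const) (simp add: summable_iff_convergent)
    then show ?case by (simp add: sum_lessThan_telescope[of "\<lambda>k. f (r k) t"])
  qed
  define l where "l t = lim (\<lambda>k. f (r k) t)" for t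
  have [measurable]: "l \<in> borel_measurable lborel"
    unfolding l_def by measurable
  have lim: "AE t in lborel. (\<lambda>k. f (r k) t) \<longlonglongrightarrow> l t"
    using conv by eventually_elim (simp add: l_def convergent_LIMSEQ_iff)
  have fatou: "(\<integral>\<^sup>+t. ennreal ((l t - f m t)\<^sup>2) \<partial>lborel) \<le> ennreal (((1/4)^k)\<^sup>2)" if m: "m \<ge> N k" for m k
  proof -
    have "(\<integral>\<^sup>+t. ennreal ((l t - f m t)\<^sup>2) \<partial>lborel) =
        (\<integral>\<^sup>+t. liminf (\<lambda>n. ennreal ((f (r n) t - f m t)\<^sup>2)) \<partial>lborel)"
    proof (rule nn_integral_cong_AE)
      from lim show "AE t in lborel. ennreal ((l t - f m t)\<^sup>2) =
          liminf (\<lambda>n. ennreal ((f (r n) t - f m t)\<^sup>2))"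
      proof eventually_elim
        case (elim t)
        then have "(\<lambda>n. ennreal ((f (r n) t - f m t)\<^sup>2)) \<longlonglongrightarrow> ennreal ((l t - f m t)\<^sup>2)"
          by (intro tendsto_intros)
        then show ?case
          by (intro lim_imp_Liminf[symmetric]) auto
      qed
    qed
    also have "\<dots> \<le> liminf (\<lambda>n. \<integral>\<^sup>+t. ennreal ((f (r n) t - f m t)\<^sup>2) \<partial>lborel)"
      by (rule nn_integral_liminf) measurable
    also have "\<dots> \<le> ennreal (((1/4)^k)\<^sup>2)"
    proof (rule Liminf_le)
      show "\<forall>\<^sub>F n in sequentially.
          (\<integral>\<^sup>+t. ennreal ((f (r n) t - f m t)\<^sup>2) \<partial>lborel) \<le> ennreal (((1/4)^k)\<^sup>2)"
        using eventually_ge_at_top[of "N k"]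
      proof eventually_elim
        case (elim n)
        then have "r n \<ge> N k" using seq_suble[OF r_mono, of n] by simp
        then have "dist (X (r n)) (X m) < (1/4)^k" using m by (intro N)
        then show ?case
          unfolding diff by (intro ennreal_leI power_mono) auto
      qed
    qed simp
    finally show ?thesis .
  qed
  have sd: "square_integrable (\<lambda>t. l t - f m t)" if "m \<ge> N k" for m k
    unfolding square_integrable_def
  proof
    show "integrable lborel (\<lambda>t. (l t - f m t)\<^sup>2)"
      using fatou[OF that] by (intro integrableI_nonneg) (auto simp: less_top[symmetric] top_unique)
  qed measurable
  have sl: "square_integrable l"
    using square_integrable_add[OF sd[of 0 "N 0"] sf[of "N 0"]] by simp
  have "dist (X m) (abs_l2 l) \<le> (1/4)^k" if "m \<ge> N k" for m k
  proof -
    have "ennreal ((norm (abs_l2 l - X m))\<^sup>2) \<le> ennreal (((1/4)^k)\<^sup>2)"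
      using fatou[OF that] nn_integral_square_l2[OF sd[OF that]]
      by (simp add: abs_l2_diff sl sf abs_f)
    then have "(norm (abs_l2 l - X m))\<^sup>2 \<le> ((1/4)^k)\<^sup>2"
      by (subst (asm) ennreal_le_iff) auto
    then have "norm (abs_l2 l - X m) \<le> (1/4)^k"
      by (rule power2_le_imp_le) simp
    then show ?thesis by (simp add: dist_norm norm_minus_commute)
  qed
  then have le: "\<exists>M. \<forall>m\<ge>M. dist (X m) (abs_l2 l) \<le> (1/4)^k" for k :: nat by blast
  have "X \<longlonglongrightarrow> abs_l2 l"
  proof (rule metric_LIMSEQ_I)
    fix e :: real assume "e > 0"
    then obtain k where "(1/4)^k < e" using real_arch_pow_inv[of e "1/4"] by auto
    with le[of k] show "\<exists>no. \<forall>n\<ge>no. dist (X n) (abs_l2 l) < e"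
      by (meson le_less_trans)
  qed
  then show "convergent X" by (rule convergentI)
qed

instance l2 :: banach ..


definition l2_step :: "(rat \<times> rat \<times> rat) list \<Rightarrow> l2" where
  "l2_step cs = (\<Sum>(c, p, q)\<leftarrow>cs.
     of_rat c *\<^sub>R abs_l2 (indicator {of_rat p..of_rat q}))"

lemma square_integrable_indicator:
  assumes "A \<in> sets borel" "A \<subseteq> {- c..c}"
  shows "square_integrable (indicator A)"
  unfolding square_integrable_def
proof
  have "emeasure lborel A \<le> emeasure lborel {- c..c}"
    using assms by (intro emeasure_mono) auto
  then have "emeasure lborel A < \<infinity>"
    by (auto simp: emeasure_lborel_Icc_eq less_top[symmetric] top_unique split: if_splits)
  then have "integrable lborel (indicator A :: real \<Rightarrow> real)"
    using assms(1) by (intro integrable_real_indicator) auto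
  moreover have "(\<lambda>t. (indicator A t)\<^sup>2) = (indicator A :: real \<Rightarrow> real)"
    by (auto simp: indicator_def)
  ultimately show "integrable lborel (\<lambda>t. (indicator A t :: real)\<^sup>2)" by simp
qed (use assms(1) in simp)

lemma closure_l2_step_lim:
  "(\<And>n. u n \<in> closure (range l2_step)) \<Longrightarrow> u \<longlonglongrightarrow> x \<Longrightarrow> x \<in> closure (range l2_step)"
  by (rule closed_sequentially[OF closed_closure])

lemma range_l2_step_lim:
  assumes "\<And>n. u n \<in> range l2_step" "u \<longlonglongrightarrow> x"
  shows "x \<in> closure (range l2_step)"
  using assms(2) by (rule closure_l2_step_lim[rotated]) (rule subsetD[OF closure_subset assms(1)])

lemma closure_l2_step_add:
  assumes "x \<in> closure (range l2_step)" "y \<in> closure (range l2_step)"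
  shows "x + y \<in> closure (range l2_step)"
proof -
  from assms obtain u v where u: "\<And>n. u n \<in> range l2_step" "u \<longlonglongrightarrow> x"
    and v: "\<And>n. v n \<in> range l2_step" "v \<longlonglongrightarrow> y"
    by (auto simp: closure_sequential)
  have "u n + v n \<in> range l2_step" for n
  proof -
    obtain a b where "u n = l2_step a" "v n = l2_step b" using u(1)[of n] v(1)[of n] by auto
    then have "u n + v n = l2_step (a @ b)" by (simp add: l2_step_def)
    then show ?thesis by simp
  qed
  moreover have "(\<lambda>n. u n + v n) \<longlonglongrightarrow> x + y" by (intro tendsto_add u v)
  ultimately show ?thesis by (rule range_l2_step_lim)
qed

lemma closure_l2_step_scaleR:
  assumes "x \<in> closure (range l2_step)"
  shows "c *\<^sub>R x \<in> closure (range l2_step)"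
proof -
  from assms obtain u where u: "\<And>n. u n \<in> range l2_step" "u \<longlonglongrightarrow> x"
    by (auto simp: closure_sequential)
  have "\<exists>d::rat. c - inverse (Suc n) < of_rat d \<and> of_rat d < c" for n
    by (rule of_rat_dense) simp
  then obtain d :: "nat \<Rightarrow> rat" where d: "\<And>n. c - inverse (Suc n) < of_rat (d n)" "\<And>n. of_rat (d n) < c"
    by metis
  have "(\<lambda>n. of_rat (d n)) \<longlonglongrightarrow> c"
  proof (rule tendsto_sandwich[where h = "\<lambda>n. c"])
    show "\<forall>\<^sub>F n in sequentially. c - inverse (real (Suc n)) \<le> of_rat (d n)"
      "\<forall>\<^sub>F n in sequentially. of_rat (d n) \<le> c"
      using d by (auto intro!: always_eventually less_imp_le simp del: of_nat_Suc)
    show "(\<lambda>n. c - inverse (real (Suc n))) \<longlonglongrightarrow> c"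
      using tendsto_diff[OF tendsto_const LIMSEQ_inverse_real_of_nat, of c] by simp
  qed simp
  then have lim: "(\<lambda>n. of_rat (d n) *\<^sub>R u n) \<longlonglongrightarrow> c *\<^sub>R x" by (intro tendsto_scaleR u)
  have "of_rat e *\<^sub>R l2_step a = l2_step (map (\<lambda>(k, p, q). (e * k, p, q)) a)" for e a
    by (induction a) (auto simp: l2_step_def scaleR_right_distrib of_rat_mult)
  then have "\<exists>b. of_rat e *\<^sub>R l2_step a = l2_step b" for e a by blast
  then have "of_rat (d n) *\<^sub>R u n \<in> range l2_step" for n
    using u(1)[of n] by (auto simp: image_iff)
  then show ?thesis using lim by (rule range_l2_step_lim)
qed

lemma closure_l2_step_zero: "0 \<in> closure (range l2_step)"
proof -
  have "l2_step [] = 0" by (simp add: l2_step_def)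
  then show ?thesis by (metis closure_subset rangeI subsetD)
qed

lemma closure_l2_step_Icc: "abs_l2 (indicator {p..q}) \<in> closure (range l2_step)"
proof -
  have "\<exists>d::rat. p - inverse (Suc n) < of_rat d \<and> of_rat d < p" for n
    by (rule of_rat_dense) simp
  then obtain d :: "nat \<Rightarrow> rat" where d: "\<And>n. p - inverse (Suc n) < of_rat (d n)" "\<And>n. of_rat (d n) < p"
    by metis
  have "\<exists>d::rat. q < of_rat d \<and> of_rat d < q + inverse (Suc n)" for n
    by (rule of_rat_dense) simp
  then obtain e :: "nat \<Rightarrow> rat" where e: "\<And>n. q < of_rat (e n)" "\<And>n. of_rat (e n) < q + inverse (Suc n)"
    by metis
  define c where "c = \<bar>p\<bar> + \<bar>q\<bar> + 1"
  have inv: "inverse (real (Suc n)) \<le> 1" for n by (simp add: field_simps)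
  have sub: "{of_rat (d n)..of_rat (e n)} \<subseteq> {- c..c}" for n
    using d(1)[of n] e(2)[of n] inv[of n] by (auto simp: c_def simp del: of_nat_Suc)
  have "(\<lambda>n. abs_l2 (indicator {of_rat (d n)..of_rat (e n)})) \<longlonglongrightarrow> abs_l2 (indicator {p..q})"
  proof (rule abs_l2_tendsto_dominated(2)[where g = "indicator {- c..c}"])
    show "square_integrable (indicator {of_rat (d n)..of_rat (e n)})" for n
      using sub by (intro square_integrable_indicator) auto
    show "square_integrable (indicator {- c..c})"
      by (intro square_integrable_indicator) auto
    show "\<bar>indicator {of_rat (d n)..of_rat (e n)} t\<bar> \<le> (indicator {- c..c} t :: real)" for n t
      using sub[of n] by (auto simp: indicator_def)
    fix t
    have inv0: "(\<lambda>n. inverse (real (Suc n))) \<longlonglongrightarrow> 0" by (rule LIMSEQ_inverse_real_of_nat)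
    have "\<forall>\<^sub>F n in sequentially. (t \<in> {of_rat (d n)..of_rat (e n)}) = (t \<in> {p..q})"
    proof -
      consider "t \<in> {p..q}" | "t < p" | "q < t" by force
      then show ?thesis
      proof cases
        case 1
        have "t \<in> {of_rat (d n)..of_rat (e n)}" for n
          using 1 d(2)[of n] e(1)[of n] by auto
        then show ?thesis using 1 by simp
      next
        case 2
        then have "\<forall>\<^sub>F n in sequentially. inverse (real (Suc n)) < p - t"
          by (intro order_tendstoD(2)[OF inv0]) simp
        then show ?thesis
        proof eventually_elim
          case (elim n)
          then show ?case using 2 d(1)[of n] by (auto simp del: of_nat_Suc)
        qed
      next
        case 3
        then have "\<forall>\<^sub>F n in sequentially. inverse (real (Suc n)) < t - q"
          by (intro order_tendstoD(2)[OF inv0]) simp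
        then show ?thesis
        proof eventually_elim
          case (elim n)
          then show ?case using 3 e(2)[of n] by (auto simp del: of_nat_Suc)
        qed
      qed
    qed
    then have "\<forall>\<^sub>F n in sequentially.
        indicator {of_rat (d n)..of_rat (e n)} t = (indicator {p..q} t :: real)"
      by eventually_elim (auto simp: indicator_def)
    then show "(\<lambda>n. indicator {of_rat (d n)..of_rat (e n)} t :: real) \<longlonglongrightarrow> indicator {p..q} t"
      by (rule tendsto_eventually)
  qed simp
  moreover have "abs_l2 (indicator {of_rat (d n)..of_rat (e n)}) \<in> closure (range l2_step)" for n
  proof -
    have "abs_l2 (indicator {of_rat (d n)..of_rat (e n)}) = l2_step [(1, d n, e n)]"
      by (simp add: l2_step_def)
    then show ?thesis by (metis closure_subset rangeI subsetD)
  qed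
  ultimately show ?thesis by (rule closure_l2_step_lim[rotated])
qed

lemma closure_l2_step_sum:
  assumes "finite I" "\<And>i. i \<in> I \<Longrightarrow> square_integrable (F i)"
    and "\<And>i. i \<in> I \<Longrightarrow> abs_l2 (F i) \<in> closure (range l2_step)"
  shows "square_integrable (\<lambda>t. \<Sum>i\<in>I. F i t)
    \<and> abs_l2 (\<lambda>t. \<Sum>i\<in>I. F i t) \<in> closure (range l2_step)"
  using assms
  by (induction I rule: finite_induct)
    (simp_all add: square_integrable_zero abs_l2_zero closure_l2_step_zero abs_l2_add
      square_integrable_add closure_l2_step_add)

lemma closure_l2_step_indicator:
  assumes "A \<in> sets borel"
  shows "abs_l2 (indicator (A \<inter> {- c..c})) \<in> closure (range l2_step)"
  using assms
proof (induction A rule: borel_set_induct)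
  case empty
  have "indicator ({} \<inter> {- c..c}) = (\<lambda>t::real. 0::real)" by (simp add: indicator_def fun_eq_iff)
  then show ?case by (simp only: abs_l2_zero closure_l2_step_zero)
next
  case (interval a b)
  then show ?case by (simp only: Int_atLeastAtMost closure_l2_step_Icc)
next
  case (compl A)
  have "indicator (- A \<inter> {- c..c}) = (\<lambda>t. indicator {- c..c} t + (- 1) * (indicator (A \<inter> {- c..c}) t :: real))"
    by (auto simp: indicator_def fun_eq_iff)
  moreover have "square_integrable (indicator (A \<inter> {- c..c}))" "square_integrable (indicator {- c..c})"
    using compl by (auto intro!: square_integrable_indicator)
  ultimately show ?case
    using compl.IH by (simp only: abs_l2_add abs_l2_cmult square_integrable_cmult)
      (intro closure_l2_step_add closure_l2_step_scaleR closure_l2_step_Icc)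
next
  case (union f)
  have sq: "square_integrable (indicator (A \<inter> {- c..c}))" if "A \<in> sets borel" for A
    using that by (auto intro!: square_integrable_indicator)
  have Un: "indicator ((\<Union>i<n. f i) \<inter> {- c..c}) = (\<lambda>t. \<Sum>i<n. indicator (f i \<inter> {- c..c}) t :: real)" for n
  proof
    fix t
    have "disjoint_family_on (\<lambda>i. f i \<inter> {- c..c}) {..<n}"
      using union.hyps(1) by (auto simp: disjoint_family_on_def)
    from indicator_UN_disjoint[OF _ this, of t]
    show "indicator ((\<Union>i<n. f i) \<inter> {- c..c}) t = (\<Sum>i<n. indicator (f i \<inter> {- c..c}) t :: real)"
      by (simp add: Int_commute)
  qed
  have "abs_l2 (indicator ((\<Union>i<n. f i) \<inter> {- c..c})) \<in> closure (range l2_step)" for n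
    unfolding Un using union by (intro conjunct2[OF closure_l2_step_sum] sq) auto
  moreover have "(\<lambda>n. abs_l2 (indicator ((\<Union>i<n. f i) \<inter> {- c..c}))) \<longlonglongrightarrow>
      abs_l2 (indicator ((\<Union>i. f i) \<inter> {- c..c}))"
  proof (rule abs_l2_tendsto_dominated(2)[where g = "indicator {- c..c}"])
    show "square_integrable (indicator ((\<Union>i<n. f i) \<inter> {- c..c}))" for n
      using union by (intro sq) auto
    show "square_integrable (indicator {- c..c})"
      by (intro square_integrable_indicator) auto
    show "indicator ((\<Union>i. f i) \<inter> {- c..c}) \<in> borel_measurable lborel"
      using union by (intro borel_measurable_indicator) auto
    show "(\<lambda>n. indicator ((\<Union>i<n. f i) \<inter> {- c..c}) t :: real) \<longlonglongrightarrow>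
        indicator ((\<Union>i. f i) \<inter> {- c..c}) t" for t
    proof (cases "t \<in> (\<Union>i. f i)")
      case True
      then obtain i where "t \<in> f i" by auto
      then have "\<forall>\<^sub>F n in sequentially. indicator ((\<Union>i<n. f i) \<inter> {- c..c}) t =
          (indicator ((\<Union>i. f i) \<inter> {- c..c}) t :: real)"
        by (intro eventually_sequentiallyI[of "Suc i"]) (auto simp: indicator_def)
      then show ?thesis by (rule tendsto_eventually)
    qed (auto simp: indicator_def)
  qed (auto simp: indicator_def)
  ultimately show ?case by (rule closure_l2_step_lim)
qed

lemma closure_range_l2_step: "closure (range l2_step) = UNIV"
proof -
  have "x \<in> closure (range l2_step)" for x
  proof -
    define f where "f = rep_l2 x"
    have sf: "square_integrable f" by (simp add: f_def square_integrable_rep)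
    then have [measurable]: "f \<in> borel_measurable lborel" by (rule square_integrable_measurable)
    obtain F where F: "\<And>i. simple_function lborel (F i)" "\<And>t. (\<lambda>i. F i t) \<longlonglongrightarrow> f t"
        "\<And>i t. \<bar>F i t\<bar> \<le> 2 * \<bar>f t\<bar>"
      using borel_measurable_implies_sequence_metric[of f lborel 0] by (auto simp: dist_real_def)
    have [measurable]: "F i \<in> borel_measurable lborel" for i
      using F(1) by (rule borel_measurable_simple_function)
    define G where "G i t = F i t * indicator {- real i..real i} t" for i t
    have GF: "\<bar>G i t\<bar> \<le> \<bar>F i t\<bar>" for i t by (auto simp: G_def indicator_def)
    have G_le: "\<bar>G i t\<bar> \<le> 2 * \<bar>f t\<bar>" for i t using GF F(3) order_trans by blast
    have f2: "square_integrable (\<lambda>t. 2 * \<bar>f t\<bar>)"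
      using sf by (intro square_integrable_cmult square_integrable_bound[of f "\<lambda>t. \<bar>f t\<bar>"]) auto
    have sG: "square_integrable (G i)" for i
    proof (rule square_integrable_bound[OF f2])
      show "G i \<in> borel_measurable lborel" unfolding G_def by measurable
    qed (use G_le in auto)
    have "(\<lambda>i. abs_l2 (G i)) \<longlonglongrightarrow> abs_l2 f"
    proof (rule abs_l2_tendsto_dominated(2)[OF sG f2 _ G_le])
      fix t
      have "\<forall>\<^sub>F i in sequentially. F i t = G i t"
        using eventually_ge_at_top[of "nat \<lceil>\<bar>t\<bar>\<rceil>"]
      proof eventually_elim
        case (elim i)
        then have "\<bar>t\<bar> \<le> real i" by linarith
        then show ?case by (auto simp: G_def indicator_def)
      qed
      with F(2) show "(\<lambda>i. G i t) \<longlonglongrightarrow> f t" by (rule Lim_transform_eventually)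
    qed measurable
    moreover have "abs_l2 (G i) \<in> closure (range l2_step)" for i
    proof -
      have fin: "finite (range (F i))" using F(1)[of i] by (simp add: simple_function_def)
      have meas: "F i -` {y} \<in> sets borel" for y
        using measurable_sets[of "F i" lborel borel "{y}"] by simp
      have sq: "square_integrable (indicator (F i -` {y} \<inter> {- real i..real i}))" for y
        using meas by (intro square_integrable_indicator) auto
      have "G i = (\<lambda>t. \<Sum>y\<in>range (F i). y * indicator (F i -` {y} \<inter> {- real i..real i}) t)"
      proof
        fix t
        have "(\<Sum>y\<in>range (F i). y * indicator (F i -` {y} \<inter> {- real i..real i}) t) =
            (\<Sum>y\<in>range (F i). if y = F i t then G i t else 0)"
          by (intro sum.cong) (auto simp: G_def indicator_def)
        also have "\<dots> = G i t" using fin by simp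
        finally show "G i t = (\<Sum>y\<in>range (F i). y * indicator (F i -` {y} \<inter> {- real i..real i}) t)" ..
      qed
      moreover have "abs_l2 (\<lambda>t. \<Sum>y\<in>range (F i). y * indicator (F i -` {y} \<inter> {- real i..real i}) t)
          \<in> closure (range l2_step)"
      proof (rule conjunct2[OF closure_l2_step_sum[OF fin]])
        fix y
        show "square_integrable (\<lambda>t. y * indicator (F i -` {y} \<inter> {- real i..real i}) t)"
          by (rule square_integrable_cmult[OF sq])
        show "abs_l2 (\<lambda>t. y * indicator (F i -` {y} \<inter> {- real i..real i}) t) \<in> closure (range l2_step)"
          unfolding abs_l2_cmult[OF sq]
          by (intro closure_l2_step_scaleR closure_l2_step_indicator meas)
      qed
      ultimately show ?thesis by simp
    qed
    ultimately have "abs_l2 f \<in> closure (range l2_step)" by (rule closure_l2_step_lim[rotated])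
    then show ?thesis by (simp add: f_def abs_rep_l2)
  qed
  then show ?thesis by auto
qed

instance l2 :: second_countable_topology
proof
  define B where "B = (\<lambda>(c, n). ball (l2_step c) (inverse (real (Suc n)))) ` UNIV"
  have "topological_basis B"
  proof (rule topological_basisI)
    show "open U" if "U \<in> B" for U using that by (auto simp: B_def)
    fix U :: "l2 set" and x assume "open U" "x \<in> U"
    then obtain e where e: "e > 0" "ball x e \<subseteq> U" by (meson open_contains_ball)
    obtain n where n: "inverse (real (Suc n)) < e / 2" using reals_Archimedean[of "e / 2"] e by auto
    have "x \<in> closure (range l2_step)" by (simp add: closure_range_l2_step)
    then obtain y where y: "y \<in> range l2_step" "dist y x < inverse (real (Suc n))"
      unfolding closure_approachable by (meson inverse_positive_iff_positive of_nat_0_less_iff zero_less_Suc)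
    then obtain c where c: "y = l2_step c" by auto
    have "ball y (inverse (real (Suc n))) \<subseteq> ball x e"
    proof
      fix z assume "z \<in> ball y (inverse (real (Suc n)))"
      then show "z \<in> ball x e"
        using y(2) n dist_triangle[of x z y] by (simp add: dist_commute del: of_nat_Suc)
    qed
    then show "\<exists>V\<in>B. x \<in> V \<and> V \<subseteq> U"
      using e(2) y(2) unfolding c
      by (intro bexI[of _ "ball (l2_step c) (inverse (real (Suc n)))"]) (auto simp: B_def simp del: of_nat_Suc)
  qed
  moreover have "countable B" unfolding B_def by (intro countable_image countableI_type)
  ultimately show "\<exists>B::l2 set set. countable B \<and> open = generate_topology B"
    using topological_basis_imp_subbasis by blast
qed


section \<open>Functional random variables and the Mahalanobis semi-distance\<close>

text \<open>
  A square integrable function on \<open>T\<close> is identified with its extension by zero to the line.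
\<close>

definition L2_on :: "real set \<Rightarrow> l2 set" where
  "L2_on T = {f. AE t in lborel. t \<notin> T \<longrightarrow> rep_l2 f t = 0}"

lemma inner_L2_on:
  assumes "T \<in> sets borel" "f \<in> L2_on T"
  shows "inner f g = (LINT t:T|lborel. rep_l2 f t * rep_l2 g t)"
proof -
  have "(AE t in lborel. t \<notin> T \<longrightarrow> rep_l2 f t = 0)" using assms(2) by (simp add: L2_on_def)
  then have ae: "AE t in lborel. rep_l2 f t * rep_l2 g t = indicator T t *\<^sub>R (rep_l2 f t * rep_l2 g t)"
    by eventually_elim (auto simp: indicator_def)
  have "inner f g = (LINT t|lborel. rep_l2 f t * rep_l2 g t)"
    using inner_l2.abs_eq[OF ae_eq_refl ae_eq_refl, OF square_integrable_rep square_integrable_rep, of f g]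
    by (simp add: abs_rep_l2)
  also have "\<dots> = (LINT t:T|lborel. rep_l2 f t * rep_l2 g t)"
    unfolding set_lebesgue_integral_def
  proof (rule integral_cong_AE[OF _ _ ae])
    have [measurable]: "rep_l2 x \<in> borel_measurable lborel" for x
      by (rule square_integrable_measurable[OF square_integrable_rep])
    have [measurable]: "T \<in> sets borel" by (rule assms(1))
    show "(\<lambda>t. rep_l2 f t * rep_l2 g t) \<in> borel_measurable lborel"
      by measurable
    show "(\<lambda>t. indicator T t *\<^sub>R (rep_l2 f t * rep_l2 g t)) \<in> borel_measurable lborel"
      by measurable
  qed
  finally show ?thesis .
qed

definition functional_random_variable :: "'w measure \<Rightarrow> real set \<Rightarrow> ('w \<Rightarrow> l2) \<Rightarrow> bool" where
  "functional_random_variable M T X \<longleftrightarrow>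
     X \<in> borel_measurable M \<and> (\<forall>\<omega>\<in>space M. X \<omega> \<in> L2_on T) \<and>
     integrable M (\<lambda>\<omega>. norm (X \<omega>) ^ 4)"

text \<open>
  Elements of \<open>l2\<close> have no pointwise values, so the expectations defining the mean function and
  the covariance operator are Bochner integrals in \<open>l2\<close>.
\<close>

definition mean_function :: "'w measure \<Rightarrow> ('w \<Rightarrow> l2) \<Rightarrow> l2" where
  "mean_function M X = (LINT \<omega>|M. X \<omega>)"

definition covariance_operator :: "'w measure \<Rightarrow> ('w \<Rightarrow> l2) \<Rightarrow> l2 \<Rightarrow> l2" where
  "covariance_operator M X \<eta> =
     (LINT \<omega>|M. inner (X \<omega> - mean_function M X) \<eta> *\<^sub>R (X \<omega> - mean_function M X))"

definition compact_operator_on :: "'a::real_normed_vector set \<Rightarrow> ('a \<Rightarrow> 'a) \<Rightarrow> bool" where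
  "compact_operator_on V A \<longleftrightarrow>
     A ` V \<subseteq> V \<and>
     (\<forall>x\<in>V. \<forall>y\<in>V. A (x + y) = A x + A y) \<and>
     (\<forall>c. \<forall>x\<in>V. A (c *\<^sub>R x) = c *\<^sub>R A x) \<and>
     (\<forall>B. B \<subseteq> V \<and> bounded B \<longrightarrow> compact (closure (A ` B)))"

text \<open>Sequences indexed by the positive integers; the value at index 0 is irrelevant.\<close>

definition orthonormal_basis_on :: "'a::real_inner set \<Rightarrow> (nat \<Rightarrow> 'a) \<Rightarrow> bool" where
  "orthonormal_basis_on V \<psi> \<longleftrightarrow>
     (\<forall>k\<ge>1. \<psi> k \<in> V) \<and>
     (\<forall>j\<ge>1. \<forall>k\<ge>1. inner (\<psi> j) (\<psi> k) = (if j = k then 1 else 0)) \<and>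
     closure (span (\<psi> ` {1..})) = V"

definition tensor_square :: "'a::real_inner \<Rightarrow> 'a \<Rightarrow> 'a" where
  "tensor_square f g = inner f g *\<^sub>R f"

definition regularized_sqrt_inverse ::
    "(nat \<Rightarrow> real) \<Rightarrow> (nat \<Rightarrow> 'a::real_inner) \<Rightarrow> nat \<Rightarrow> 'a \<Rightarrow> 'a" where
  "regularized_sqrt_inverse lam \<psi> K \<zeta> =
     (\<Sum>k = 1..K. (1 / sqrt (lam k)) *\<^sub>R tensor_square (\<psi> k) \<zeta>)"

definition mahalanobis_semi_distance ::
    "(nat \<Rightarrow> real) \<Rightarrow> (nat \<Rightarrow> 'a::real_inner) \<Rightarrow> nat \<Rightarrow> 'a \<Rightarrow> 'a \<Rightarrow> real" where
  "mahalanobis_semi_distance lam \<psi> K x y =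
     sqrt (inner (regularized_sqrt_inverse lam \<psi> K (x - y))
                 (regularized_sqrt_inverse lam \<psi> K (x - y)))"

definition functional_semi_distance :: "'a set \<Rightarrow> ('a \<Rightarrow> 'a \<Rightarrow> real) \<Rightarrow> bool" where
  "functional_semi_distance V d \<longleftrightarrow>
     (\<forall>x\<in>V. \<forall>y\<in>V. 0 \<le> d x y) \<and>
     (\<forall>x\<in>V. \<forall>y\<in>V. d x y = d y x) \<and>
     (\<forall>x\<in>V. \<forall>y\<in>V. \<forall>z\<in>V. d x y \<le> d x z + d z y)"

end

theory Submission
  imports Defs
begin

text \<open>
  The Mahalanobis semi-distance is the pullback of the norm metric along a linear map:
  \<open>d x y = \<parallel>A x - A y\<parallel>\<close>, where \<open>A\<close> is the regularized square root inverse. It is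
  therefore non-negative, symmetric and subadditive at every triple of points, and these
  properties pass to each realisation of the random functions. Since \<open>A\<close> only sees the first
  \<open>K\<close> coordinates, nothing forces distinct points to be separated.
\<close>

lemma regularized_sqrt_inverse_diff:
  "regularized_sqrt_inverse lam \<psi> K (x - y) =
     regularized_sqrt_inverse lam \<psi> K x - regularized_sqrt_inverse lam \<psi> K y"
  by (simp add: regularized_sqrt_inverse_def tensor_square_def inner_diff_right
      scaleR_diff_left scaleR_diff_right sum_subtractf)

lemma mahalanobis_semi_distance_eq_dist:
  "mahalanobis_semi_distance lam \<psi> K x y =
     dist (regularized_sqrt_inverse lam \<psi> K x) (regularized_sqrt_inverse lam \<psi> K y)"
  by (simp add: mahalanobis_semi_distance_def regularized_sqrt_inverse_diff dist_norm
      norm_eq_sqrt_inner)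

lemma functional_semi_distance_mahalanobis:
  "functional_semi_distance V (mahalanobis_semi_distance lam \<psi> K)"
  unfolding functional_semi_distance_def mahalanobis_semi_distance_eq_dist
  by (intro conjI ballI zero_le_dist dist_commute dist_triangle)

theorem proposition2p3:
  fixes M :: "'w measure"
    and a b :: real
    and X :: "nat \<Rightarrow> 'w \<Rightarrow> l2"
    and \<mu> :: l2
    and \<Gamma> :: "l2 \<Rightarrow> l2"
    and lam :: "nat \<Rightarrow> real"
    and \<psi> :: "nat \<Rightarrow> l2"
    and K :: nat
  assumes "prob_space M"
    and "a < b"
    and "\<And>i. i \<in> {1, 2, 3} \<Longrightarrow> functional_random_variable M {a..b} (X i)"
    and "prob_space.indep_vars M (\<lambda>_. borel) X {1, 2, 3}"
    and "\<And>i j. i \<in> {1, 2, 3} \<Longrightarrow> j \<in> {1, 2, 3} \<Longrightarrow>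
           distr M borel (X i) = distr M borel (X j)"
    and "\<And>i. i \<in> {1, 2, 3} \<Longrightarrow> mean_function M (X i) = \<mu>"
    and "\<And>i. i \<in> {1, 2, 3} \<Longrightarrow> covariance_operator M (X i) = \<Gamma>"
    and "compact_operator_on (L2_on {a..b}) \<Gamma>"
    and "orthonormal_basis_on (L2_on {a..b}) \<psi>"
    and "\<And>k. 1 \<le> k \<Longrightarrow> \<Gamma> (\<psi> k) = lam k *\<^sub>R \<psi> k"
    and "\<And>j k. 1 \<le> j \<Longrightarrow> j \<le> k \<Longrightarrow> lam k \<le> lam j"
    and "\<And>k. 1 \<le> k \<Longrightarrow> 0 \<le> lam k"
    and "summable (\<lambda>k. lam (Suc k))"
    and "1 \<le> K"
    and "0 < lam K"
  shows "let d = mahalanobis_semi_distance lam \<psi> K in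
    (\<forall>\<omega>\<in>space M. 0 \<le> d (X 1 \<omega>) (X 2 \<omega>)) \<and>
    (\<forall>\<omega>\<in>space M. d (X 1 \<omega>) (X 2 \<omega>) = d (X 2 \<omega>) (X 1 \<omega>)) \<and>
    (\<forall>\<omega>\<in>space M. d (X 1 \<omega>) (X 2 \<omega>) \<le> d (X 1 \<omega>) (X 3 \<omega>) + d (X 3 \<omega>) (X 2 \<omega>)) \<and>
    functional_semi_distance (L2_on {a..b}) d"
  using functional_semi_distance_mahalanobis[of UNIV lam \<psi> K]
    functional_semi_distance_mahalanobis[of "L2_on {a..b}" lam \<psi> K]
  unfolding Let_def by (intro conjI ballI) (unfold functional_semi_distance_def, blast+)

end
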